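(* Let $s$ be a positive integer and let $\mathcal{H}$ be a nonempty $s$-uniform hypergraph. Suppose that $q \in (0,1)$ and $K > 0$ are such that $q \cdot v(\mathcal{H}) \geq 10^8 s^6 K$ and, for every $t \in \{1, \dotsc, s\}$, \[ \Delta_t(\mathcal{H}) \leq K \cdot \left(\frac{q}{10^6 s^5}\right)^{t-1} \cdot \frac{e(\mathcal{H})}{v(\mathcal{H})}. \] Then there exist a family $\mathcal{S}$ of subsets of $V(\mathcal{H})$, each of cardinality at most $q \cdot v(\mathcal{H})$, and functions $f \colon \mathcal{S} \to \mathcal{P}(V(\mathcal{H}))$ and $g \colon \mathcal{I}(\mathcal{H}) \to \mathcal{S}$ such that, for every $I \in \mathcal{I}(\mathcal{H})$, \[ g(I) \subseteq I \subseteq g(I) \cup f(g(I)) \qquad \text{and} \qquad |f(g(I))| \leq (1-\delta) \cdot v(\mathcal{H}), \] where $\delta = (10^3 s^4 K)^{-1}$. Moreover, if $g(I) \subseteq I'$ and $g(I') \subseteq I$ for some $I, I' \in \mathcal{I}(\mathcal{H})$, then $g(I) = g(I')$.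
   Context: All hypergraphs are finite. A hypergraph is $s$-uniform if each of its edges is a set of exactly $s$ vertices; edges may have positive integer multiplicities, and edges are always counted with multiplicity. A hypergraph $\mathcal{H}$ has vertex set $V(\mathcal{H})$ and edge set $E(\mathcal{H})$; $v(\mathcal{H})$ and $e(\mathcal{H})$ are the numbers of its vertices and edges; it is nonempty if it has at least one edge. For $T \subseteq V(\mathcal{H})$, $\deg_{\mathcal{H}} T = |\{A \in E(\mathcal{H}) : T \subseteq A\}|$, and $\Delta_t(\mathcal{H}) = \max\{\deg_{\mathcal{H}} T : T \subseteq V(\mathcal{H}),\ |T| = t\}$. $\mathcal{I}(\mathcal{H})$ is the family of independent sets of $\mathcal{H}$, i.e. subsets of $V(\mathcal{H})$ containing no edge of $\mathcal{H}$. $\mathcal{P}(X)$ is the power set of $X$. *)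

theory Defs
  imports Complex_Main "HOL-Library.Multiset" "HOL-Library.FuncSet"
begin

text \<open>Edges form a multiset, so \<open>size\<close> and \<open>filter_mset\<close> count them with multiplicity.\<close>

record 'a hypergraph =
  vertices :: "'a set"
  edges :: "'a set multiset"

definition hypergraph :: "'a hypergraph \<Rightarrow> bool" where
  "hypergraph H \<longleftrightarrow> finite (vertices H) \<and> (\<forall>A\<in>#edges H. A \<subseteq> vertices H)"

definition uniform :: "nat \<Rightarrow> 'a hypergraph \<Rightarrow> bool" where
  "uniform s H \<longleftrightarrow> (\<forall>A\<in>#edges H. card A = s)"

definition num_vertices :: "'a hypergraph \<Rightarrow> nat" where
  "num_vertices H = card (vertices H)"

definition num_edges :: "'a hypergraph \<Rightarrow> nat" where
  "num_edges H = size (edges H)"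

definition degree :: "'a hypergraph \<Rightarrow> 'a set \<Rightarrow> nat" where
  "degree H T = size {#A \<in># edges H. T \<subseteq> A#}"

text \<open>The maximum ranges over a nonempty set exactly when the hypergraph has at least \<open>t\<close>
  vertices; this holds for every \<open>t \<le> s\<close> if the hypergraph is \<open>s\<close>-uniform and has an edge.\<close>

definition max_degree :: "nat \<Rightarrow> 'a hypergraph \<Rightarrow> nat" where
  "max_degree t H = Max {degree H T | T. T \<subseteq> vertices H \<and> card T = t}"

definition independent_sets :: "'a hypergraph \<Rightarrow> 'a set set" where
  "independent_sets H = {I. I \<subseteq> vertices H \<and> (\<forall>A\<in>#edges H. \<not> A \<subseteq> I)}"

end

theory Submission
  imports Defs "HOL-Analysis.Convex"
begin

text \<open>The independent set \<open>I\<close> is probed by queries "is \<open>v\<close> in \<open>I\<close>?". The vertices that answer yes form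
the fingerprint \<open>g(I)\<close>, and the aim is to certify that at least \<open>\<delta> v(H)\<close> vertices lie outside \<open>I\<close>;
the container is the complement of these. Since the queries are the branches of a fixed decision
tree, a fingerprint determines its branch. This yields \<open>f\<close> and the consistency property
(\<open>query_tree_consistent\<close>).

The knowledge about \<open>I\<close> is stored as a nonnegative weight \<open>m\<close> on the \<open>i\<close>-sets that \<open>I\<close> does not
contain, initially the normalised edge multiset with \<open>i = s\<close>. Write \<open>m(U)\<close> for the total
weight of the sets containing \<open>U\<close>. The spread of \<open>m\<close> is measured by one quadratic form, the energy
\<open>\<Sum>\<^sub>U p\<^bsup>-|U|\<^esup> m(U)\<^sup>2\<close> over nonempty \<open>U\<close>, with \<open>p = q / (10\<^sup>6 s\<^sup>4)\<close>. If \<open>v\<close> turns out to be in \<open>I\<close>,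
then the link of \<open>v\<close> in \<open>m\<close> is a weight on \<open>(i-1)\<close>-sets that \<open>I\<close> does not contain; if not, \<open>v\<close> is
removed. Adding up the links of \<open>O(p s\<^sup>2 v(H))\<close> vertices gives a weight \<open>l\<close> on \<open>(i-1)\<close>-sets. After
\<open>s - 1\<close> such rounds the weight lives on singletons, all of them outside \<open>I\<close>, and by
Cauchy-Schwarz a unit weight on singletons with energy at most \<open>\<rho>\<close> charges at least \<open>1/(p \<rho>)\<close>
vertices (\<open>shrinks_by_singletons\<close>). The removed vertices serve as a certificate as soon as there are
\<open>\<delta> v(H)\<close> of them; up to that point they carry little of the weight, again because
the energy is small.

What makes this efficient is that the energy relative to the squared total weight grows only by
\<open>1 + 1/s\<close> in each round, hence by a factor at most \<open>3\<close> overall. Indeed, averaged over \<open>v\<close>, the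
correlation of \<open>l\<close> with the link of \<open>v\<close> costs at most \<open>(i-1)/v(H)\<close> times the correlation of \<open>l\<close>
with \<open>m\<close> (\<open>sum_corr_link\<close>), while the weight of the link is \<open>i/v(H)\<close> on average. The difference
between \<open>i\<close> and \<open>i - 1\<close> pays for the energies of the single links (\<open>sum_energy_link\<close>) and for the
removed vertices. So some vertex is good for weight and energy simultaneously
(\<open>select_vertex\<close>), and querying such vertices keeps the ratio under control whatever \<open>I\<close> is.
The degree bounds on the hypergraph make the initial energy small (\<open>energy_le_of_deg_le\<close>).\<close>

section \<open>Query trees\<close>

datatype 'a query_tree = Leaf "'a set" | Query 'a "'a query_tree" "'a query_tree"

fun fingerprint :: "'a query_tree \<Rightarrow> 'a set \<Rightarrow> 'a set" where
  "fingerprint (Leaf D) I = {}"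
| "fingerprint (Query v yes no) I =
     (if v \<in> I then insert v (fingerprint yes I) else fingerprint no I)"

fun removed :: "'a query_tree \<Rightarrow> 'a set \<Rightarrow> 'a set" where
  "removed (Leaf D) I = D"
| "removed (Query v yes no) I = (if v \<in> I then removed yes I else removed no I)"

lemma fingerprint_subset: "fingerprint T I \<subseteq> I"
  by (induction T) auto

text \<open>At the first vertex where the branches of \<open>I\<close> and \<open>J\<close> part, one of the two sets contains the vertex
and puts it into its fingerprint, while the other set misses it.\<close>

lemma query_tree_consistent:
  assumes "fingerprint T I \<subseteq> J" "fingerprint T J \<subseteq> I"
  shows "fingerprint T I = fingerprint T J \<and> removed T I = removed T J"
  using assms by (induction T) (auto split: if_splits)

section \<open>Weights on sets and their energy\<close>

lemma one_plus_inverse_power_le: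
  assumes "s \<ge> 1" "j \<le> s"
  shows "(1 + 1 / real s) ^ j \<le> 3"
proof -
  have "(1 + 1 / real s) ^ j \<le> (1 + 1 / real s) ^ s"
    using assms by (intro power_increasing) auto
  also have "\<dots> \<le> exp (1 / real s) ^ s"
    by (intro power_mono exp_ge_add_one_self) auto
  also have "\<dots> = exp 1" using assms by (simp add: exp_of_nat_mult[symmetric])
  also have "\<dots> \<le> 3" by (rule exp_le)
  finally show ?thesis .
qed

lemma sum_power_card_Pow:
  fixes z :: real
  assumes "finite A"
  shows "(\<Sum>U\<in>Pow A. z ^ card U) = (1 + z) ^ card A"
  using prod_add[OF assms, of "\<lambda>_. z" "\<lambda>_. 1"] by (simp add: add.commute)

locale weighted_sets =
  fixes V :: "'a set" and p :: real
  assumes finite_V: "finite V" and p_pos: "p > 0"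
begin

definition deg :: "('a set \<Rightarrow> real) \<Rightarrow> 'a set \<Rightarrow> real" where
  "deg m U = (\<Sum>A | A \<subseteq> V \<and> U \<subseteq> A. m A)"

text \<open>The empty set is left out of the sum: it would contribute the product of the total weights. If \<open>p \<le> 1\<close>
and \<open>R\<close> is a \<open>p\<close>-random set, the form with \<open>1/p - 1\<close> in place of \<open>1/p\<close> is the covariance of the numbers of
sets inside \<open>R\<close>, each set \<open>A\<close> counted with weight \<open>l A / p\<^bsup>|A|\<^esup>\<close> and \<open>m A / p\<^bsup>|A|\<^esup>\<close>, respectively.\<close>

definition corr :: "('a set \<Rightarrow> real) \<Rightarrow> ('a set \<Rightarrow> real) \<Rightarrow> real" where
  "corr l m = (\<Sum>U\<in>Pow V - {{}}. (1/p) ^ card U * (deg l U * deg m U))"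

abbreviation energy :: "('a set \<Rightarrow> real) \<Rightarrow> real" where
  "energy m \<equiv> corr m m"

definition weights :: "nat \<Rightarrow> ('a set \<Rightarrow> real) \<Rightarrow> bool" where
  "weights i m \<longleftrightarrow> (\<forall>A. m A \<ge> 0) \<and> (\<forall>A. m A \<noteq> 0 \<longrightarrow> A \<subseteq> V \<and> card A = i)"

definition link :: "('a set \<Rightarrow> real) \<Rightarrow> 'a \<Rightarrow> 'a set \<Rightarrow> real" where
  "link m v T = (if v \<in> T then 0 else m (insert v T))"

definition avoids :: "'a set \<Rightarrow> ('a set \<Rightarrow> real) \<Rightarrow> bool" where
  "avoids I m \<longleftrightarrow> (\<forall>A. m A \<noteq> 0 \<longrightarrow> \<not> A \<subseteq> I)"

lemma finite_above: "finite {A. A \<subseteq> V \<and> P A}"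
  by (rule finite_subset[of _ "Pow V"]) (auto simp: finite_V)

lemma deg_nonneg: "weights i m \<Longrightarrow> deg m U \<ge> 0"
  unfolding deg_def weights_def by (intro sum_nonneg) auto

lemma deg_add: "deg (\<lambda>A. l A + m A) U = deg l U + deg m U"
  unfolding deg_def by (simp add: sum.distrib)

lemma deg_scale: "deg (\<lambda>A. c * m A) U = c * deg m U"
  unfolding deg_def by (simp add: sum_distrib_left)

lemma deg_link:
  assumes v: "v \<in> V"
  shows "deg (link m v) U = (if v \<in> U then 0 else deg m (insert v U))"
proof (cases "v \<in> U")
  case True
  then show ?thesis unfolding deg_def link_def by (auto intro!: sum.neutral)
next
  case False
  have "deg (link m v) U = (\<Sum>A | A \<subseteq> V \<and> U \<subseteq> A \<and> v \<notin> A. m (insert v A))"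
    unfolding deg_def
    by (rule sum.mono_neutral_cong_right) (auto simp: finite_above link_def)
  also have "\<dots> = deg m (insert v U)"
    unfolding deg_def
    by (rule sum.reindex_bij_witness[of _ "\<lambda>A. A - {v}" "insert v"]) (use v False in auto)
  finally show ?thesis using False by simp
qed

lemma weights_link:
  assumes m: "weights i m" and v: "v \<in> V"
  shows "weights (i - 1) (link m v)"
  unfolding weights_def
proof (intro conjI allI impI)
  fix T
  show "link m v T \<ge> 0" using m unfolding weights_def link_def by simp
  assume "link m v T \<noteq> 0"
  then have T: "v \<notin> T" "m (insert v T) \<noteq> 0" unfolding link_def by (auto split: if_splits)
  then have A: "insert v T \<subseteq> V" "card (insert v T) = i" using m unfolding weights_def by blast+
  then show "T \<subseteq> V" by simp
  then have "finite T" using finite_V by (rule finite_subset)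
  then show "card T = i - 1" using A T by simp
qed

lemma avoids_link: "avoids I m \<Longrightarrow> v \<in> I \<Longrightarrow> avoids I (link m v)"
  unfolding avoids_def link_def by auto

lemma deg_eq_0:
  assumes "weights i m" "card U > i" 
  shows "deg m U = 0"
  unfolding deg_def
proof (rule sum.neutral, clarify)
  fix A assume A: "A \<subseteq> V" "U \<subseteq> A"
  have "card U \<le> card A" by (rule card_mono) (use A finite_V finite_subset in auto)
  then show "m A = 0" using assms unfolding weights_def by force
qed

text \<open>Double counting: an \<open>i\<close>-set above \<open>U\<close> has \<open>i - |U|\<close> vertices outside \<open>U\<close>.\<close>

lemma sum_deg_insert:
  assumes m: "weights i m" and U: "U \<subseteq> V"
  shows "(\<Sum>v\<in>V - U. deg m (insert v U)) = (real i - real (card U)) * deg m U"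
proof -
  have "(\<Sum>v\<in>V - U. deg m (insert v U))
      = (\<Sum>v\<in>V - U. \<Sum>A | A \<subseteq> V \<and> U \<subseteq> A. if v \<in> A then m A else 0)"
    unfolding deg_def
    by (intro sum.cong refl sum.mono_neutral_cong_left) (auto simp: finite_above)
  also have "\<dots> = (\<Sum>A | A \<subseteq> V \<and> U \<subseteq> A. \<Sum>v\<in>V - U. if v \<in> A then m A else 0)"
    by (rule sum.swap)
  also have "\<dots> = (\<Sum>A | A \<subseteq> V \<and> U \<subseteq> A. (real i - real (card U)) * m A)"
  proof (rule sum.cong[OF refl], clarify)
    fix A assume A: "A \<subseteq> V" "U \<subseteq> A"
    have fA: "finite A" using A finite_V finite_subset by blast
    have "(\<Sum>v\<in>V - U. if v \<in> A then m A else 0) = (\<Sum>v\<in>A - U. m A)"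
      by (rule sum.mono_neutral_cong_right) (use A finite_V in auto)
    also have "\<dots> = real (card (A - U)) * m A" by simp
    also have "real (card (A - U)) = real (card A) - real (card U)"
      using A fA by (simp add: card_Diff_subset finite_subset of_nat_diff card_mono)
    finally show "(\<Sum>v\<in>V - U. if v \<in> A then m A else 0) = (real i - real (card U)) * m A"
      using m unfolding weights_def by (cases "m A = 0") auto
  qed
  finally show ?thesis unfolding deg_def by (simp add: sum_distrib_left)
qed

lemma sum_vertex_deg: "weights i m \<Longrightarrow> (\<Sum>v\<in>V. deg m {v}) = real i * deg m {}"
  using sum_deg_insert[of i m "{}"] by simp

lemma corr_nonneg: "weights i l \<Longrightarrow> weights j m \<Longrightarrow> corr l m \<ge> 0"
  unfolding corr_def using p_pos by (intro sum_nonneg mult_nonneg_nonneg deg_nonneg) auto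

lemma energy_add: "energy (\<lambda>A. l A + m A) = energy l + 2 * corr l m + energy m"
  unfolding corr_def deg_add
  by (simp add: sum.distrib[symmetric] sum_distrib_left algebra_simps)

lemma energy_scale: "energy (\<lambda>A. c * m A) = c\<^sup>2 * energy m"
  unfolding corr_def deg_scale
  by (simp add: sum_distrib_left algebra_simps power2_eq_square)

text \<open>This form of Cauchy-Schwarz avoids square roots of energies: the only application has a natural
value for \<open>t\<close>.\<close>

lemma corr_am_gm:
  assumes "t > 0"
  shows "2 * corr l m \<le> t * energy m + energy l / t"
proof -
  have "2 * (a * b) \<le> t * (b * b) + (a * a) / t" for a b :: real
  proof -
    have "0 \<le> (a - t * b)\<^sup>2 / t" using assms by simp
    then show ?thesis using assms by (simp add: field_simps power2_eq_square)
  qed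
  then have "(1/p) ^ card U * (2 * (deg l U * deg m U))
      \<le> (1/p) ^ card U * (t * (deg m U * deg m U) + (deg l U * deg l U) / t)" for U
    using p_pos by (intro mult_left_mono) auto
  then have "(\<Sum>U\<in>Pow V - {{}}. (1/p) ^ card U * (2 * (deg l U * deg m U)))
     \<le> (\<Sum>U\<in>Pow V - {{}}. (1/p) ^ card U * (t * (deg m U * deg m U) + (deg l U * deg l U) / t))"
    by (intro sum_mono)
  then show ?thesis
    unfolding corr_def
    by (simp add: sum_distrib_left sum_divide_distrib sum.distrib[symmetric] algebra_simps)
qed

text \<open>The factor is \<open>i - |U|\<close> on the part of the form that belongs to \<open>U\<close>, and \<open>U\<close> is nonempty. Gaining
this \<open>1\<close> against the average weight of a link, whose factor is \<open>i\<close>, is what keeps the energy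
from growing over many rounds.\<close>

lemma sum_corr_link:
  assumes m: "weights i m" and l: "weights j l" and i: "i \<ge> 1"
  shows "(\<Sum>v\<in>V. corr l (link m v)) \<le> (real i - 1) * corr l m"
proof -
  have "(\<Sum>v\<in>V. corr l (link m v))
      = (\<Sum>U\<in>Pow V - {{}}. \<Sum>v\<in>V. (1/p) ^ card U * (deg l U * deg (link m v) U))"
    unfolding corr_def by (rule sum.swap)
  also have "\<dots> = (\<Sum>U\<in>Pow V - {{}}. (1/p) ^ card U * (deg l U * (\<Sum>v\<in>V. deg (link m v) U)))"
    by (simp add: sum_distrib_left)
  also have "\<dots> \<le> (\<Sum>U\<in>Pow V - {{}}. (1/p) ^ card U * (deg l U * ((real i - 1) * deg m U)))"
  proof (intro sum_mono mult_left_mono)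
    fix U assume U: "U \<in> Pow V - {{}}"
    then have c: "card U \<ge> 1" using finite_V
      by (metis Diff_iff PowD card_0_eq finite_subset insertI1 less_one not_le)
    have "(\<Sum>v\<in>V. deg (link m v) U) = (\<Sum>v\<in>V - U. deg m (insert v U))"
      by (rule sum.mono_neutral_cong_right) (auto simp: finite_V deg_link)
    also have "\<dots> = (real i - real (card U)) * deg m U"
      using sum_deg_insert[OF m] U by auto
    also have "\<dots> \<le> (real i - 1) * deg m U"
      using c deg_nonneg[OF m] by (intro mult_right_mono) auto
    finally show "(\<Sum>v\<in>V. deg (link m v) U) \<le> (real i - 1) * deg m U" .
  qed (use p_pos deg_nonneg[OF l] in auto)
  also have "\<dots> = (real i - 1) * corr l m"
    unfolding corr_def by (simp add: sum_distrib_left mult_ac)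
  finally show ?thesis .
qed

text \<open>The part of the energy of the link of \<open>v\<close> that belongs to \<open>U\<close> is \<open>p\<close> times the part of the energy of
\<open>m\<close> that belongs to \<open>U \<union> {v}\<close>, and every set arises from at most \<open>i\<close> of its vertices.\<close>

lemma sum_energy_link:
  assumes m: "weights i m"
  shows "(\<Sum>v\<in>V. energy (link m v)) \<le> real i * p * energy m"
proof -
  let ?g = "\<lambda>U. (1/p) ^ card U * (deg m U * deg m U)"
  have g0: "?g U \<ge> 0" for U using p_pos by simp
  have "energy (link m v) \<le> p * (\<Sum>U\<in>Pow V - {{}}. if v \<in> U then ?g U else 0)"
    if v: "v \<in> V" for v
  proof -
    have "energy (link m v) = (\<Sum>U | U \<subseteq> V \<and> U \<noteq> {} \<and> v \<notin> U. p * ?g (insert v U))"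
      unfolding corr_def
    proof (rule sum.mono_neutral_cong_right)
      fix U assume "U \<in> {U. U \<subseteq> V \<and> U \<noteq> {} \<and> v \<notin> U}"
      then have U: "U \<subseteq> V" "v \<notin> U" by auto
      then have "card (insert v U) = Suc (card U)"
        using finite_V finite_subset by (metis card_insert_disjoint)
      then show "(1/p) ^ card U * (deg (link m v) U * deg (link m v) U) = p * ?g (insert v U)"
        using p_pos U v by (simp add: deg_link)
    qed (use v in \<open>auto simp: finite_V deg_link\<close>)
    also have "\<dots> = (\<Sum>U\<in>insert v ` {U. U \<subseteq> V \<and> U \<noteq> {} \<and> v \<notin> U}. p * ?g U)"
      by (subst sum.reindex) (auto simp: inj_on_def dest: insert_ident)
    also have "\<dots> = p * (\<Sum>U\<in>insert v ` {U. U \<subseteq> V \<and> U \<noteq> {} \<and> v \<notin> U}. if v \<in> U then ?g U else 0)"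
      unfolding sum_distrib_left by (rule sum.cong) auto
    also have "\<dots> \<le> p * (\<Sum>U\<in>Pow V - {{}}. if v \<in> U then ?g U else 0)"
      using p_pos v by (intro mult_left_mono sum_mono2) (auto simp: finite_V g0)
    finally show ?thesis .
  qed
  then have "(\<Sum>v\<in>V. energy (link m v))
      \<le> (\<Sum>v\<in>V. p * (\<Sum>U\<in>Pow V - {{}}. if v \<in> U then ?g U else 0))"
    by (intro sum_mono)
  also have "\<dots> = p * (\<Sum>U\<in>Pow V - {{}}. \<Sum>v\<in>V. if v \<in> U then ?g U else 0)"
    unfolding sum_distrib_left[symmetric] by (subst sum.swap) (rule refl)
  also have "\<dots> \<le> p * (\<Sum>U\<in>Pow V - {{}}. real i * ?g U)"
  proof (intro mult_left_mono sum_mono)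
    fix U assume U: "U \<in> Pow V - {{}}"
    have "(\<Sum>v\<in>V. if v \<in> U then ?g U else 0) = (\<Sum>v\<in>U. ?g U)"
      by (rule sum.mono_neutral_cong_right) (use U finite_V in auto)
    also have "\<dots> = real (card U) * ?g U" by simp
    also have "\<dots> \<le> real i * ?g U"
    proof (cases "card U \<le> i")
      case True then show ?thesis using g0 by (intro mult_right_mono) auto
    next
      case False then show ?thesis using deg_eq_0[OF m, of U] by simp
    qed
    finally show "(\<Sum>v\<in>V. if v \<in> U then ?g U else 0) \<le> real i * ?g U" .
  qed (use p_pos in auto)
  also have "\<dots> = real i * p * energy m"
    unfolding corr_def by (simp add: sum_distrib_left mult_ac)
  finally show ?thesis .
qed

text \<open>Few vertices carry little weight: Cauchy-Schwarz, and the singletons alone contribute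
\<open>p\<^bsup>-1\<^esup> \<Sum> (deg m {v})\<^sup>2\<close> to the energy.\<close>

lemma vertex_energy:
  assumes D: "D \<subseteq> V"
  shows "(\<Sum>v\<in>D. deg m {v})\<^sup>2 \<le> real (card D) * p * energy m"
proof -
  have fD: "finite D" using D finite_V finite_subset by blast
  have "(\<Sum>v\<in>D. (deg m {v})\<^sup>2) = p * (\<Sum>U\<in>(\<lambda>v. {v}) ` D. (1/p) ^ card U * (deg m U * deg m U))"
    using p_pos by (subst sum.reindex) (auto simp: sum_distrib_left power2_eq_square)
  also have "\<dots> \<le> p * energy m"
    unfolding corr_def using p_pos D
    by (intro mult_left_mono sum_mono2) (auto simp: finite_V)
  finally have "real (card D) * (\<Sum>v\<in>D. (deg m {v})\<^sup>2) \<le> real (card D) * (p * energy m)"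
    by (intro mult_left_mono) auto
  then show ?thesis using sum_squared_le_sum_of_squares[of "\<lambda>v. deg m {v}" D] by (simp add: mult_ac)
qed

section \<open>Building a weight of lower uniformity\<close>

text \<open>One step of a round. The invariant bounds the energy of the accumulated links by \<open>\<rho>\<close> times
\<open>L\<^sup>2 + 4 p i L\<close>, where \<open>L\<close> is their total weight. The linear term absorbs the energies of the single
links and is negligible once \<open>L\<close> is large compared with \<open>p i\<close>. The vertex is found by averaging one
quantity, \<open>gain\<close>, which charges the growth of the energy against the growth of the bound. As
some vertex has a gain of at least \<open>\<rho> t / (2 |V|)\<close> and not merely a nonnegative one, the weight of its
link is bounded below as well.\<close>

lemma select_vertex:
  assumes m: "weights i m" and i: "i \<ge> 1" and m1: "deg m {} = 1"
    and rho: "energy m \<le> \<rho>" "\<rho> > 0"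
    and l: "weights j l" and lE: "energy l \<le> \<rho> * ((deg l {})\<^sup>2 + 4 * p * real i * deg l {})"
    and D: "D \<subseteq> V" "(\<Sum>v\<in>D. deg m {v}) \<le> 1/2"
  obtains v where "v \<in> V - D" "deg m {v} \<ge> 1 / (4 * real (card V))"
    "energy (\<lambda>A. l A + link m v A)
       \<le> \<rho> * ((deg l {} + deg m {v})\<^sup>2 + 4 * p * real i * (deg l {} + deg m {v}))"
proof -
  define L where "L = deg l {}"
  define t where "t = L + 2 * p * real i"
  have L: "L \<ge> 0" unfolding L_def by (rule deg_nonneg[OF l])
  have pi: "p * real i > 0" using p_pos i by simp
  have t: "t > 0" "t \<ge> 2 * (p * real i)" unfolding t_def using L pi by auto
  \<comment> \<open>Completing the square in the invariant makes \<open>t\<close> the right parameter for \<open>corr_am_gm\<close>.\<close>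
  have "energy l \<le> \<rho> * t\<^sup>2"
  proof -
    have "L\<^sup>2 + 4 * p * real i * L \<le> t\<^sup>2"
    proof -
      have "t\<^sup>2 = L\<^sup>2 + 4 * p * real i * L + (2 * (p * real i))\<^sup>2"
        unfolding t_def by (simp add: power2_eq_square algebra_simps)
      then show ?thesis by simp
    qed
    then show ?thesis using lE rho(2) unfolding L_def[symmetric]
      by (meson dual_order.trans mult_left_mono less_imp_le)
  qed
  then have "energy l / t \<le> \<rho> * t"
    using t by (simp add: divide_le_eq power2_eq_square mult_ac)
  moreover have "t * energy m \<le> t * \<rho>" using rho t by (intro mult_left_mono) auto
  ultimately have cross: "2 * corr l m \<le> 2 * \<rho> * t"
    using corr_am_gm[OF t(1), of l m] by (simp add: mult_ac)
  define gain where "gain v = 2 * \<rho> * t * deg m {v} - 2 * corr l (link m v) - energy (link m v)" for v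
  have sub: "(\<Sum>v\<in>V - D. f v) \<le> (\<Sum>v\<in>V. f v)" if "\<And>v. v \<in> V \<Longrightarrow> f v \<ge> 0" for f :: "'a \<Rightarrow> real"
    using that finite_V by (intro sum_mono2) auto
  have a1: "(\<Sum>v\<in>V - D. 2 * corr l (link m v)) \<le> (real i - 1) * (2 * \<rho> * t)"
  proof -
    have "(\<Sum>v\<in>V - D. corr l (link m v)) \<le> (\<Sum>v\<in>V. corr l (link m v))"
      by (rule sub) (use corr_nonneg[OF l weights_link[OF m]] in auto)
    also have "\<dots> \<le> (real i - 1) * corr l m" by (rule sum_corr_link[OF m l i])
    finally have "2 * (\<Sum>v\<in>V - D. corr l (link m v)) \<le> (real i - 1) * (2 * corr l m)" by simp
    also have "\<dots> \<le> (real i - 1) * (2 * \<rho> * t)" using cross i by (intro mult_left_mono) auto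
    finally show ?thesis by (simp add: sum_distrib_left)
  qed
  have a2: "(\<Sum>v\<in>V - D. energy (link m v)) \<le> p * real i * \<rho>"
  proof -
    have "(\<Sum>v\<in>V - D. energy (link m v)) \<le> (\<Sum>v\<in>V. energy (link m v))"
      by (rule sub) (use corr_nonneg weights_link[OF m] in blast)
    also have "\<dots> \<le> real i * p * energy m" by (rule sum_energy_link[OF m])
    also have "\<dots> \<le> real i * p * \<rho>" using rho p_pos by (intro mult_left_mono) auto
    finally show ?thesis by (simp add: mult_ac)
  qed
  have a3: "(\<Sum>v\<in>V - D. deg m {v}) \<ge> real i - 1/2"
  proof -
    have "(\<Sum>v\<in>V - D. deg m {v}) = real i - (\<Sum>v\<in>D. deg m {v})"
      using sum_vertex_deg[OF m] m1 D finite_V by (simp add: sum_diff)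
    then show ?thesis using D by simp
  qed
  have "\<rho> * t / 2 \<le> \<rho> * t - p * real i * \<rho>"
  proof -
    have "\<rho> * (2 * (p * real i)) \<le> \<rho> * t" using t rho by (intro mult_left_mono) auto
    then show ?thesis by (simp add: algebra_simps)
  qed
  also have "\<dots> = 2 * \<rho> * t * (real i - 1/2) - (real i - 1) * (2 * \<rho> * t) - p * real i * \<rho>"
    by (simp add: algebra_simps)
  also have "\<dots> \<le> 2 * \<rho> * t * (\<Sum>v\<in>V - D. deg m {v})
      - (\<Sum>v\<in>V - D. 2 * corr l (link m v)) - (\<Sum>v\<in>V - D. energy (link m v))"
    using a1 a2 a3 rho t by (intro diff_mono mult_left_mono) auto
  also have "\<dots> = (\<Sum>v\<in>V - D. gain v)"
    unfolding gain_def by (simp add: sum_subtractf sum_distrib_left)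
  finally have total: "\<rho> * t / 2 \<le> (\<Sum>v\<in>V - D. gain v)" .
  have rt: "\<rho> * t > 0" using rho t by simp
  have ne: "V - D \<noteq> {}"
  proof
    assume e: "V - D = {}"
    have "\<rho> * t / 2 \<le> 0" using total unfolding e by simp
    then show False using rt by simp
  qed
  have cV: "card V > 0" using ne finite_V by (auto simp: card_gt_0_iff)
  obtain v where v: "v \<in> V - D" "gain v \<ge> \<rho> * t / (2 * real (card V))"
  proof (rule ccontr)
    assume "\<not> thesis"
    then have "\<And>v. v \<in> V - D \<Longrightarrow> gain v < \<rho> * t / (2 * real (card V))" using that by force
    then have "(\<Sum>v\<in>V - D. gain v) < (\<Sum>v\<in>V - D. \<rho> * t / (2 * real (card V)))"
      using ne finite_V by (intro sum_strict_mono) auto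
    also have "\<dots> = real (card (V - D)) * (\<rho> * t / (2 * real (card V)))" by simp
    also have "\<dots> \<le> real (card V) * (\<rho> * t / (2 * real (card V)))"
      using rt finite_V by (intro mult_right_mono) (auto intro: card_mono)
    also have "\<dots> = \<rho> * t / 2" using cV by simp
    finally show False using total by simp
  qed
  have n1: "corr l (link m v) \<ge> 0" "energy (link m v) \<ge> 0"
    using v corr_nonneg[OF l weights_link[OF m]] corr_nonneg[OF weights_link[OF m] weights_link[OF m]]
    by auto
  have "\<rho> * t / (2 * real (card V)) \<le> 2 * \<rho> * t * deg m {v}"
    using v n1 unfolding gain_def by simp
  then have y: "deg m {v} \<ge> 1 / (4 * real (card V))"
    using rt cV rho t by (simp add: field_simps)
  have "gain v \<ge> 0"
    using v(2) rt by (rule_tac order_trans[OF _ v(2)]) auto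
  then have "energy (\<lambda>A. l A + link m v A) \<le> energy l + 2 * \<rho> * t * deg m {v}"
    unfolding energy_add gain_def by simp
  also have "\<dots> \<le> \<rho> * (L\<^sup>2 + 4 * p * real i * L) + 2 * \<rho> * t * deg m {v}"
    using lE unfolding L_def by simp
  also have "\<dots> \<le> \<rho> * ((L + deg m {v})\<^sup>2 + 4 * p * real i * (L + deg m {v}))"
    unfolding t_def using rho by (simp add: power2_eq_square algebra_simps)
  finally show thesis using that v(1) y unfolding L_def by blast
qed

section \<open>Decision trees that shrink an independent set\<close>

definition shrinks :: "real \<Rightarrow> nat \<Rightarrow> 'a query_tree \<Rightarrow> 'a set \<Rightarrow> bool" where
  "shrinks d k T I \<longleftrightarrow>
     card (fingerprint T I) \<le> k \<and> removed T I \<subseteq> V - I \<and> d \<le> real (card (removed T I))"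

lemma deg_eq:
  assumes "weights i m" "card U = i" "U \<subseteq> V"
  shows "deg m U = m U"
proof -
  have "deg m U = (\<Sum>A\<in>{U}. m A)"
    unfolding deg_def
  proof (rule sum.mono_neutral_right)
    show "\<forall>A\<in>{A. A \<subseteq> V \<and> U \<subseteq> A} - {U}. m A = 0"
    proof
      fix A assume A: "A \<in> {A. A \<subseteq> V \<and> U \<subseteq> A} - {U}"
      then have "U \<subset> A" "finite A" using finite_V finite_subset by auto
      then have "card A > i" using assms psubset_card_mono by blast
      then show "m A = 0" using assms unfolding weights_def by force
    qed
  qed (use assms in \<open>auto simp: finite_above\<close>)
  then show ?thesis by simp
qed

text \<open>
All vertices that carry weight lie outside \<open>I\<close>, so no query is needed; by \<open>vertex_energy\<close> a unit
weight of small energy cannot sit on few vertices.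
\<close>

lemma shrinks_by_singletons:
  assumes m: "weights 1 m" and m1: "deg m {} = 1"
    and rho: "energy m \<le> \<rho>" and d: "p * \<rho> * d \<le> 1" "d \<ge> 0"
  shows "\<exists>T. \<forall>I\<subseteq>V. avoids I m \<longrightarrow> shrinks d 0 T I"
proof (intro exI allI impI)
  define D where "D = {v \<in> V. m {v} \<noteq> 0}"
  fix I assume I: "I \<subseteq> V" "avoids I m"
  have D: "D \<subseteq> V" unfolding D_def by auto
  have "(\<Sum>v\<in>D. deg m {v}) = (\<Sum>v\<in>V. deg m {v})"
    using D deg_eq[OF m] by (intro sum.mono_neutral_left) (auto simp: D_def finite_V)
  also have "\<dots> = 1" using sum_vertex_deg[OF m] m1 by simp
  finally have "1 \<le> real (card D) * p * energy m"
    using vertex_energy[OF D, of m] by simp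
  also have "\<dots> \<le> real (card D) * p * \<rho>" using rho p_pos by (intro mult_left_mono) auto
  finally have one: "1 \<le> real (card D) * (p * \<rho>)" by (simp add: mult_ac)
  have "p * \<rho> > 0"
  proof (rule ccontr)
    assume "\<not> p * \<rho> > 0"
    then have "real (card D) * (p * \<rho>) \<le> 0"
      using mult_nonneg_nonpos[of "real (card D)" "p * \<rho>"] by linarith
    then show False using one by simp
  qed
  moreover have "(p * \<rho>) * d \<le> (p * \<rho>) * real (card D)" using one d by (simp add: mult_ac)
  ultimately have "d \<le> real (card D)" using mult_le_cancel_left_pos by blast
  moreover have "D \<inter> I = {}" using I unfolding D_def avoids_def by auto
  ultimately show "shrinks d 0 (Leaf D) I" using D unfolding shrinks_def by auto
qed

text \<open>One round. Each positive answer adds a link of weight at least \<open>1/(4 |V|)\<close> to \<open>l\<close>, so \<open>N\<close> positive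
answers give the stated total weight. Each negative answer enlarges the set \<open>D\<close> of vertices known to
be outside \<open>I\<close>. As long as \<open>|D| < d\<close>, the set \<open>D\<close> carries weight at most \<open>1/2\<close> and the next vertex
can be selected outside \<open>D\<close>. A vertex may be selected again after a positive answer: its link is
then added once more, which keeps the weight available without enlarging the fingerprint.\<close>

lemma shrinks_by_links:
  assumes m: "weights i m" and i: "i \<ge> 1" and m1: "deg m {} = 1"
    and rho: "energy m \<le> \<rho>" "\<rho> > 0" and d: "4 * p * \<rho> * d \<le> 1"
    and step: "\<And>l. weights (i - 1) l \<Longrightarrow> deg l {} \<ge> real N / (4 * real (card V))
      \<Longrightarrow> energy l \<le> \<rho> * ((deg l {})\<^sup>2 + 4 * p * real i * deg l {})
      \<Longrightarrow> \<exists>T. \<forall>I\<subseteq>V. avoids I l \<longrightarrow> shrinks d k T I"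
  shows "\<exists>T. \<forall>I\<subseteq>V. avoids I m \<longrightarrow> shrinks d (k + N) T I"
proof -
  \<comment> \<open>Here \<open>n\<close> is the number of positive answers that are still missing.\<close>
  have main: "\<exists>T. \<forall>I\<subseteq>V. avoids I m \<longrightarrow> avoids I l \<longrightarrow> I \<inter> D = {} \<longrightarrow> shrinks d (k + n) T I"
    if "D \<subseteq> V" "weights (i - 1) l"
      "deg l {} \<ge> (real N - real n) / (4 * real (card V))"
      "energy l \<le> \<rho> * ((deg l {})\<^sup>2 + 4 * p * real i * deg l {})" for D l n
    using that
  proof (induction "n + card (V - D)" arbitrary: D l n rule: less_induct)
    case less
    consider "d \<le> real (card D)" | "real (card D) < d" "n = 0" | "real (card D) < d" "n > 0"
      by linarith
    then show ?case
    proof cases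
      case 1
      then show ?thesis using less.prems(1)
        by (intro exI[of _ "Leaf D"]) (auto simp: shrinks_def)
    next
      case 2
      then show ?thesis using step[OF less.prems(2)] less.prems(3,4) by auto
    next
      case 3
      have "(\<Sum>v\<in>D. deg m {v})\<^sup>2 \<le> real (card D) * p * energy m"
        by (rule vertex_energy[OF less.prems(1)])
      also have "\<dots> \<le> d * p * \<rho>"
        using 3 p_pos rho corr_nonneg[OF m m] by (intro mult_mono) auto
      also have "\<dots> \<le> (1/2)\<^sup>2" using d by (simp add: power2_eq_square mult_ac)
      finally have "(\<Sum>v\<in>D. deg m {v}) \<le> 1/2" by (rule power2_le_imp_le) simp
      then obtain v where v: "v \<in> V - D" "deg m {v} \<ge> 1 / (4 * real (card V))"
        "energy (\<lambda>A. l A + link m v A)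
          \<le> \<rho> * ((deg l {} + deg m {v})\<^sup>2 + 4 * p * real i * (deg l {} + deg m {v}))"
        using select_vertex[OF m i m1 rho less.prems(2,4,1)] by blast
      define l' where "l' = (\<lambda>A. l A + link m v A)"
      have vV: "v \<in> V" using v by auto
      have dl': "deg l' {} = deg l {} + deg m {v}"
        unfolding l'_def by (simp add: deg_add deg_link[OF vV])
      have wl': "weights (i - 1) l'"
        using less.prems(2) weights_link[OF m vV] unfolding l'_def weights_def
        by (metis add.right_neutral add_nonneg_nonneg)
      have "(real N - real (n - 1)) / (4 * real (card V))
          = (real N - real n) / (4 * real (card V)) + 1 / (4 * real (card V))"
        using 3 by (simp add: of_nat_diff add_divide_distrib[symmetric])
      then have "(real N - real (n - 1)) / (4 * real (card V)) \<le> deg l' {}"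
        using v(2) less.prems(3) unfolding dl' by linarith
      then obtain Y where Y: "\<And>I. I \<subseteq> V \<Longrightarrow> avoids I m \<Longrightarrow> avoids I l' \<Longrightarrow> I \<inter> D = {}
          \<Longrightarrow> shrinks d (k + (n - 1)) Y I"
        using less.hyps[of "n - 1" D l'] less.prems(1) wl' v(3) 3
        unfolding dl' l'_def[symmetric] by auto
      have "card (V - insert v D) < card (V - D)"
        using v finite_V by (intro psubset_card_mono) auto
      then obtain X where X: "\<And>I. I \<subseteq> V \<Longrightarrow> avoids I m \<Longrightarrow> avoids I l \<Longrightarrow> I \<inter> insert v D = {}
          \<Longrightarrow> shrinks d (k + n) X I"
        using less.hyps[of n "insert v D" l] less.prems vV by auto
      have "shrinks d (k + n) (Query v Y X) I"
        if I: "I \<subseteq> V" "avoids I m" "avoids I l" "I \<inter> D = {}" for I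
      proof (cases "v \<in> I")
        case True
        have "avoids I l'"
          using I(3) avoids_link[OF I(2) True] unfolding avoids_def l'_def
          by (metis add.right_neutral)
        then have "shrinks d (k + (n - 1)) Y I" using Y I by blast
        moreover have "card (insert v (fingerprint Y I)) \<le> Suc (card (fingerprint Y I))"
          by (rule card_insert_le_m1) auto
        ultimately show ?thesis using True 3 unfolding shrinks_def by auto
      next
        case False
        then show ?thesis using X[of I] I unfolding shrinks_def by auto
      qed
      then show ?thesis by blast
    qed
  qed
  have z: "deg (\<lambda>_. 0) U = 0" for U unfolding deg_def by simp
  have "energy (\<lambda>_. 0) = 0" unfolding corr_def z by simp
  then show ?thesis
    using main[of "{}" "\<lambda>_. 0" N] z by (simp add: weights_def avoids_def)
qed

text \<open>A round from uniformity \<open>i \<le> s\<close> ends with \<open>L \<ge> 4 p s\<^sup>2 \<ge> 4 p i s\<close>, so the linear term \<open>4 p i L\<close> of the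
invariant is at most \<open>L\<^sup>2/s\<close>, and after normalising \<open>l\<close> its energy is at most \<open>\<rho> (1 + 1/s)\<close>.\<close>

lemma shrinking_tree:
  assumes "weights (Suc j) m" "deg m {} = 1" "energy m \<le> \<rho>" "\<rho> > 0"
    and "4 * p * (\<rho> * (1 + 1 / real s) ^ j) * d \<le> 1" "d \<ge> 0" "Suc j \<le> s"
    and N: "real N \<ge> 16 * p * (real s)\<^sup>2 * real (card V)" and V: "V \<noteq> {}"
  shows "\<exists>T. \<forall>I\<subseteq>V. avoids I m \<longrightarrow> shrinks d (j * N) T I"
  using assms(1-7)
proof (induction j arbitrary: m \<rho>)
  case 0
  have "0 \<le> p * \<rho> * d" using 0 p_pos by simp
  moreover have "4 * (p * \<rho> * d) \<le> 1" using 0 by (simp add: mult_ac)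
  ultimately have "p * \<rho> * d \<le> 1" by linarith
  then show ?case using shrinks_by_singletons[of m \<rho> d] 0 by auto
next
  case (Suc j)
  define i where "i = Suc (Suc j)"
  have s: "real i \<le> real s" "real s > 0" using Suc.prems unfolding i_def by auto
  have cV: "real (card V) > 0" using V finite_V by (simp add: card_gt_0_iff)
  have pow: "(1 + 1 / real s) ^ Suc j \<ge> 1" by (rule one_le_power) simp
  have "4 * p * \<rho> * d * 1 \<le> 4 * p * \<rho> * d * (1 + 1 / real s) ^ Suc j"
    using p_pos Suc.prems by (intro mult_left_mono[OF pow]) auto
  also have "\<dots> \<le> 1" using Suc.prems(5) by (simp add: mult_ac)
  finally have d: "4 * p * \<rho> * d \<le> 1" by simp
  have "\<exists>T. \<forall>I\<subseteq>V. avoids I m \<longrightarrow> shrinks d (j * N + N) T I"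
  proof (rule shrinks_by_links[of i m \<rho>])
    fix l assume l: "weights (i - 1) l" "deg l {} \<ge> real N / (4 * real (card V))"
      "energy l \<le> \<rho> * ((deg l {})\<^sup>2 + 4 * p * real i * deg l {})"
    define L where "L = deg l {}"
    have "4 * p * (real s)\<^sup>2 \<le> real N / (4 * real (card V))"
      using N cV by (simp add: field_simps)
    then have L: "4 * p * (real s)\<^sup>2 \<le> L" using l(2) unfolding L_def by simp
    have L0: "L > 0" using p_pos s by (intro less_le_trans[OF _ L]) simp
    have "4 * p * real i * real s \<le> 4 * p * (real s)\<^sup>2"
      using s p_pos by (simp add: power2_eq_square)
    then have "4 * p * real i \<le> L / real s" using L s by (simp add: field_simps)
    then have "4 * p * real i * L \<le> L / real s * L" using L0 by (intro mult_right_mono) auto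
    then have "L\<^sup>2 + 4 * p * real i * L \<le> L\<^sup>2 * (1 + 1 / real s)"
      by (simp add: power2_eq_square algebra_simps)
    then have "energy l \<le> \<rho> * (L\<^sup>2 * (1 + 1 / real s))"
      using l(3) Suc.prems(4) unfolding L_def[symmetric]
      by (meson dual_order.trans mult_left_mono less_imp_le)
    then have e: "energy (\<lambda>A. (1 / L) * l A) \<le> \<rho> * (1 + 1 / real s)"
      unfolding energy_scale using L0 by (simp add: field_simps power2_eq_square)
    have "weights (Suc j) (\<lambda>A. (1 / L) * l A)"
      using l(1) L0 unfolding weights_def i_def by auto
    moreover have "deg (\<lambda>A. (1 / L) * l A) {} = 1" unfolding deg_scale using L0 L_def by simp
    moreover have "4 * p * (\<rho> * (1 + 1 / real s) * (1 + 1 / real s) ^ j) * d \<le> 1"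
      using Suc.prems(5) by (simp add: mult_ac)
    moreover have "\<rho> * (1 + 1 / real s) > 0" using Suc.prems(4) by (simp add: add_pos_nonneg)
    ultimately obtain T where "\<forall>I\<subseteq>V. avoids I (\<lambda>A. (1 / L) * l A) \<longrightarrow> shrinks d (j * N) T I"
      using Suc.IH[OF _ _ e] Suc.prems(6,7) by auto
    then show "\<exists>T. \<forall>I\<subseteq>V. avoids I l \<longrightarrow> shrinks d (j * N) T I"
      unfolding avoids_def using L0 by auto
  qed (use Suc.prems d in \<open>auto simp: i_def\<close>)
  then show ?case by (simp add: add.commute)
qed

section \<open>The initial energy\<close>

lemma sum_power_deg:
  assumes m: "weights i m"
  shows "(\<Sum>U\<in>Pow V. z ^ card U * deg m U) = (1 + z) ^ i * deg m {}"
proof -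
  have "(\<Sum>U\<in>Pow V. z ^ card U * deg m U)
      = (\<Sum>U\<in>Pow V. \<Sum>A\<in>Pow V. if U \<subseteq> A then z ^ card U * m A else 0)"
    unfolding deg_def sum_distrib_left
    by (intro sum.cong refl sum.mono_neutral_cong_left) (auto simp: finite_V)
  also have "\<dots> = (\<Sum>A\<in>Pow V. \<Sum>U\<in>Pow V. if U \<subseteq> A then z ^ card U * m A else 0)"
    by (rule sum.swap)
  also have "\<dots> = (\<Sum>A\<in>Pow V. (1 + z) ^ i * m A)"
  proof (rule sum.cong[OF refl])
    fix A assume A: "A \<in> Pow V"
    then have fA: "finite A" using finite_V finite_subset by auto
    have "(\<Sum>U\<in>Pow V. if U \<subseteq> A then z ^ card U * m A else 0) = (\<Sum>U\<in>Pow A. z ^ card U * m A)"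
      by (rule sum.mono_neutral_cong_right) (use A finite_V in auto)
    also have "\<dots> = (1 + z) ^ card A * m A"
      using sum_power_card_Pow[OF fA, of z] by (simp add: sum_distrib_right[symmetric])
    finally show "(\<Sum>U\<in>Pow V. if U \<subseteq> A then z ^ card U * m A else 0) = (1 + z) ^ i * m A"
      using m unfolding weights_def by (cases "m A = 0") auto
  qed
  also have "\<dots> = (1 + z) ^ i * deg m {}"
    unfolding deg_def by (simp add: sum_distrib_left Pow_def)
  finally show ?thesis .
qed

text \<open>One of the two factors \<open>deg m U\<close> in the energy is replaced by its upper bound. As \<open>p\<close> exceeds \<open>\<tau>\<close> by the factor \<open>s\<close>,
a set \<open>U\<close> then gets the coefficient \<open>s\<^bsup>-|U|\<^esup>\<close>, which beats the number of subsets of an edge: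
summing over the nonempty subsets of an \<open>s\<close>-set gives \<open>(1 + 1/s)\<^sup>s - 1 \<le> 2\<close>.\<close>

lemma energy_le_of_deg_le:
  assumes m: "weights s m" and m1: "deg m {} = 1" and s: "s \<ge> 1"
    and \<tau>: "p = real s * \<tau>" "\<tau> > 0" and c: "c \<ge> 0"
    and deg: "\<And>U. U \<subseteq> V \<Longrightarrow> 1 \<le> card U \<Longrightarrow> card U \<le> s \<Longrightarrow> deg m U \<le> c * \<tau> ^ (card U - 1)"
  shows "energy m \<le> 2 * c / \<tau>"
proof -
  have "energy m \<le> (\<Sum>U\<in>Pow V - {{}}. (c / \<tau>) * ((1 / real s) ^ card U * deg m U))"
    unfolding corr_def
  proof (rule sum_mono)
    fix U assume U: "U \<in> Pow V - {{}}"
    then have cU: "card U \<ge> 1" using finite_V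
      by (metis Diff_iff PowD card_0_eq finite_subset insertI1 less_one not_le)
    have "deg m U \<le> (c / \<tau>) * \<tau> ^ card U"
    proof (cases "card U \<le> s")
      case True
      have "\<tau> ^ card U = \<tau> * \<tau> ^ (card U - 1)" using cU by (cases "card U") auto
      then show ?thesis using deg[of U] U True cU \<tau> by simp
    next
      case False then show ?thesis using deg_eq_0[OF m, of U] c \<tau> by simp
    qed
    then have "(1/p) ^ card U * (deg m U * deg m U)
        \<le> (1/p) ^ card U * ((c / \<tau>) * \<tau> ^ card U * deg m U)"
      using p_pos deg_nonneg[OF m] by (intro mult_left_mono mult_right_mono) auto
    also have "\<dots> = (c / \<tau>) * (((1/p) ^ card U * \<tau> ^ card U) * deg m U)" by simp
    also have "(1/p) ^ card U * \<tau> ^ card U = (1 / real s) ^ card U"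
      using \<tau> s by (simp add: power_mult_distrib[symmetric])
    finally show "(1/p) ^ card U * (deg m U * deg m U)
        \<le> (c / \<tau>) * ((1 / real s) ^ card U * deg m U)" .
  qed
  also have "\<dots> = (c / \<tau>) * ((\<Sum>U\<in>Pow V. (1 / real s) ^ card U * deg m U) - 1)"
    unfolding sum_distrib_left[symmetric] using m1 finite_V
    by (subst sum_diff) auto
  also have "\<dots> = (c / \<tau>) * ((1 + 1 / real s) ^ s - 1)"
    using sum_power_deg[OF m] m1 by simp
  also have "\<dots> \<le> (c / \<tau>) * 2"
    using c \<tau> one_plus_inverse_power_le[OF s order_refl] by (intro mult_left_mono) auto
  finally show ?thesis by (simp add: mult_ac)
qed

end

section \<open>Containers\<close>

definition edge_weight :: "'a hypergraph \<Rightarrow> 'a set \<Rightarrow> real" where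
  "edge_weight H A = real (count (edges H) A) / real (num_edges H)"

lemma edge_weight_deg:
  assumes H: "hypergraph H"
  shows "(\<Sum>A | A \<subseteq> vertices H \<and> U \<subseteq> A. edge_weight H A) = real (degree H U) / real (num_edges H)"
proof -
  have fin: "finite {A. A \<subseteq> vertices H \<and> U \<subseteq> A}"
    by (rule finite_subset[of _ "Pow (vertices H)"]) (use H in \<open>auto simp: hypergraph_def\<close>)
  have "degree H U = (\<Sum>A\<in>set_mset {#A \<in># edges H. U \<subseteq> A#}. count {#A \<in># edges H. U \<subseteq> A#} A)"
    unfolding degree_def by (rule size_multiset_overloaded_eq)
  also have "\<dots> = (\<Sum>A | A \<subseteq> vertices H \<and> U \<subseteq> A. count (edges H) A)"
    by (rule sum.mono_neutral_cong_left)
       (use H fin in \<open>auto simp: hypergraph_def not_in_iff\<close>)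
  finally show ?thesis unfolding edge_weight_def by (simp add: sum_divide_distrib)
qed

lemma degree_le_max_degree:
  assumes "hypergraph H" "U \<subseteq> vertices H"
  shows "degree H U \<le> max_degree (card U) H"
proof -
  have "finite {degree H T | T. T \<subseteq> vertices H \<and> card T = card U}"
    by (rule finite_subset[of _ "degree H ` Pow (vertices H)"])
       (use assms in \<open>auto simp: hypergraph_def\<close>)
  then show ?thesis unfolding max_degree_def by (rule Max_ge) (use assms in auto)
qed

theorem theorem1p1:
  fixes H :: "'a hypergraph" and s :: nat and q K :: real
  assumes "s \<ge> 1"
    and "hypergraph H" and "uniform s H" and "edges H \<noteq> {#}"
    and "0 < q" and "q < 1" and "K > 0"
    and "q * real (num_vertices H) \<ge> 10 ^ 8 * real s ^ 6 * K"
    and "\<forall>t\<in>{1..s}. real (max_degree t H)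
           \<le> K * (q / (10 ^ 6 * real s ^ 5)) ^ (t - 1)
                * (real (num_edges H) / real (num_vertices H))"
  shows "\<exists>(\<S> :: 'a set set) (f :: 'a set \<Rightarrow> 'a set) (g :: 'a set \<Rightarrow> 'a set).
      (\<forall>S\<in>\<S>. S \<subseteq> vertices H \<and> real (card S) \<le> q * real (num_vertices H)) \<and>
      f \<in> \<S> \<rightarrow> Pow (vertices H) \<and>
      g \<in> independent_sets H \<rightarrow> \<S> \<and>
      (\<forall>I\<in>independent_sets H.
         g I \<subseteq> I \<and> I \<subseteq> g I \<union> f (g I) \<and>
         real (card (f (g I))) \<le> (1 - inverse (10 ^ 3 * real s ^ 4 * K)) * real (num_vertices H)) \<and>
      (\<forall>I\<in>independent_sets H. \<forall>I'\<in>independent_sets H.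
         g I \<subseteq> I' \<and> g I' \<subseteq> I \<longrightarrow> g I = g I')"
proof -
  define V where "V = vertices H"
  define n where "n = real (card V)"
  define \<tau> where "\<tau> = q / (10 ^ 6 * real s ^ 5)"
  define p where "p = real s * \<tau>"
  define m where "m = edge_weight H"
  define d where "d = inverse (10 ^ 3 * real s ^ 4 * K) * n"
  define N where "N = nat \<lceil>16 * p * (real s)\<^sup>2 * n\<rceil>"
  define \<rho> where "\<rho> = 2 * (K / n) / \<tau>"
  have s: "real s \<ge> 1" using assms(1) by simp
  have fV: "finite V" using assms(2) unfolding V_def hypergraph_def by simp
  have e: "real (num_edges H) > 0" using assms(4) unfolding num_edges_def by (simp add: nonempty_has_size)
  obtain A where A: "A \<in># edges H" using assms(4) by blast
  then have "A \<subseteq> V" "card A = s" using assms(2,3) unfolding hypergraph_def uniform_def V_def by auto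
  then have V: "V \<noteq> {}" using assms(1) by auto
  have n: "n > 0" unfolding n_def using V fV by (simp add: card_gt_0_iff)
  have nv: "real (num_vertices H) = n" unfolding n_def V_def num_vertices_def by simp
  have \<tau>: "\<tau> > 0" unfolding \<tau>_def using assms(5) s by simp
  have p: "p > 0" unfolding p_def using \<tau> s by simp
  interpret weighted_sets V p by unfold_locales (use fV p in auto)
  have m: "weights s m"
    unfolding weights_def
  proof (intro conjI allI impI)
    fix A
    show "m A \<ge> 0" unfolding m_def edge_weight_def by simp
    assume "m A \<noteq> 0"
    then have "A \<in># edges H" unfolding m_def edge_weight_def by (auto simp: not_in_iff)
    then show "A \<subseteq> V" "card A = s"
      using assms(2,3) unfolding V_def hypergraph_def uniform_def by auto
  qed
  have dm: "deg m U = real (degree H U) / real (num_edges H)" for U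
    using edge_weight_deg[OF assms(2), of U] unfolding deg_def by (simp add: m_def V_def)
  have m1: "deg m {} = 1" unfolding dm using assms(4) by (simp add: degree_def num_edges_def)
  have deg: "deg m U \<le> (K / n) * \<tau> ^ (card U - 1)" if U: "U \<subseteq> V" "1 \<le> card U" "card U \<le> s" for U
  proof -
    have "real (degree H U) \<le> real (max_degree (card U) H)"
      using degree_le_max_degree[OF assms(2)] U(1) unfolding V_def by simp
    also have "\<dots> \<le> K * \<tau> ^ (card U - 1) * (real (num_edges H) / n)"
      using assms(9) U unfolding \<tau>_def nv by auto
    finally show ?thesis unfolding dm using e by (simp add: field_simps)
  qed
  \<comment> \<open>The vertex degrees add up to \<open>s\<close> times the number of edges. This is needed to absorb the
    rounding in \<open>N\<close>, which costs up to one vertex per round, into \<open>q n / 2\<close>.\<close>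
  have sK: "real s \<le> K"
  proof -
    have "real s = (\<Sum>v\<in>V. deg m {v})" using sum_vertex_deg[OF m] m1 by simp
    also have "\<dots> \<le> (\<Sum>v\<in>V. K / n)"
      using deg[of "{v}" for v] assms(1) by (intro sum_mono) auto
    also have "\<dots> = K" using n unfolding n_def by simp
    finally show ?thesis .
  qed
  have rho: "energy m \<le> \<rho>" unfolding \<rho>_def
    by (rule energy_le_of_deg_le[OF m m1 assms(1) p_def \<tau> _ deg]) (use assms(7) n in auto)
  have rho0: "\<rho> > 0" unfolding \<rho>_def using assms(7) n \<tau> by simp
  have d: "d \<ge> 0" unfolding d_def using assms(7) n by simp
  \<comment> \<open>This is where \<open>\<delta>\<close> has to be small: \<open>\<rho>\<close> may triple over all rounds, and the removed vertices
    must carry weight at most \<open>1/2\<close>.\<close>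
  have small: "4 * p * (\<rho> * (1 + 1 / real s) ^ (s - 1)) * d \<le> 1"
  proof -
    have "4 * p * (\<rho> * (1 + 1 / real s) ^ (s - 1)) * d \<le> 4 * p * (\<rho> * 3) * d"
      using p rho0 d one_plus_inverse_power_le[OF assms(1), of "s - 1"]
      by (intro mult_right_mono mult_left_mono) auto
    also have "\<dots> = 24 / (10 ^ 3 * real s ^ 3)"
      unfolding p_def \<rho>_def d_def using n \<tau> s assms(7)
      by (simp add: field_simps power_numeral_reduce)
    also have "\<dots> \<le> 1"
      using one_le_power[OF s, of 3] by (simp add: divide_le_eq)
    finally show ?thesis .
  qed
  have N: "real N \<ge> 16 * p * (real s)\<^sup>2 * real (card V)"
    unfolding N_def n_def by (rule real_nat_ceiling_ge)
  have Ss: "Suc (s - 1) = s" using assms(1) by simp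
  obtain T where T: "\<And>I. I \<subseteq> V \<Longrightarrow> avoids I m \<Longrightarrow> shrinks d ((s - 1) * N) T I"
    using shrinking_tree[of "s - 1" m \<rho> s d N] m m1 rho rho0 small d N V unfolding Ss by auto
  have budget: "real ((s - 1) * N) \<le> q * n"
  proof -
    have "real N \<le> 16 * p * (real s)\<^sup>2 * n + 1"
      unfolding N_def using p n by (simp add: of_nat_ceiling)
    then have "real ((s - 1) * N) \<le> real s * (16 * p * (real s)\<^sup>2 * n + 1)"
      unfolding of_nat_mult using p n by (intro mult_mono) auto
    also have "\<dots> = 16 / 10 ^ 6 * (q * n / real s) + real s"
      unfolding p_def \<tau>_def using s by (simp add: field_simps power_numeral_reduce)
    also have "\<dots> \<le> 16 / 10 ^ 6 * (q * n) + real s"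
      using s assms(5) n by (simp add: divide_le_eq)
    also have "real s \<le> q * n / 2"
    proof -
      have "2 * K \<le> 10 ^ 8 * real s ^ 6 * K"
        using one_le_power[OF s, of 6] assms(7) by (intro mult_right_mono) auto
      then show ?thesis using assms(8) sK unfolding nv by linarith
    qed
    finally have "real ((s - 1) * N) \<le> 16 / 10 ^ 6 * (q * n) + q * n / 2" by simp
    also have "\<dots> \<le> q * n"
    proof -
      have "16 / 10 ^ 6 * x + x / 2 \<le> x" if "x \<ge> 0" for x :: real using that by simp
      then show ?thesis using assms(5) n by simp
    qed
    finally show ?thesis .
  qed
  have ind: "shrinks d ((s - 1) * N) T I" if "I \<in> independent_sets H" for I
    using that e by (intro T)
      (auto simp: independent_sets_def V_def avoids_def m_def edge_weight_def count_eq_zero_iff)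
  have loss: "real (card (V - R)) \<le> (1 - inverse (10 ^ 3 * real s ^ 4 * K)) * n"
    if "R \<subseteq> V" "d \<le> real (card R)" for R
  proof -
    have "card R \<le> card V" using that fV by (intro card_mono)
    then have "real (card (V - R)) = n - real (card R)"
      using that fV unfolding n_def by (simp add: card_Diff_subset finite_subset of_nat_diff)
    then show ?thesis using that unfolding d_def by (simp add: algebra_simps)
  qed
  \<comment> \<open>The fingerprint of \<open>I\<close> follows the branch of \<open>I\<close>, so \<open>f\<close> can be read off from it.\<close>
  have removed_fingerprint: "removed T (fingerprint T I) = removed T I" for I
    using query_tree_consistent[of T I "fingerprint T I"] fingerprint_subset[of T]
    by (metis order_refl order_trans)
  let ?g = "fingerprint T" and ?f = "\<lambda>S. V - removed T S"
  have "?g I \<subseteq> V \<and> real (card (?g I)) \<le> q * n" if "I \<in> independent_sets H" for I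
  proof
    show "?g I \<subseteq> V" using that fingerprint_subset[of T I] unfolding independent_sets_def V_def by auto
    have "real (card (?g I)) \<le> real ((s - 1) * N)"
      using ind[OF that] unfolding shrinks_def of_nat_le_iff by simp
    then show "real (card (?g I)) \<le> q * n" using budget by linarith
  qed
  moreover have "?g I \<subseteq> I \<and> I \<subseteq> ?g I \<union> ?f (?g I) \<and>
      real (card (?f (?g I))) \<le> (1 - inverse (10 ^ 3 * real s ^ 4 * K)) * n"
    if "I \<in> independent_sets H" for I
  proof -
    have "I \<subseteq> V" using that unfolding independent_sets_def V_def by simp
    moreover have "removed T I \<subseteq> V - I" "d \<le> real (card (removed T I))"
      using ind[OF that] unfolding shrinks_def by auto
    ultimately show ?thesis
      using fingerprint_subset[of T I] loss[of "removed T I"] unfolding removed_fingerprint by auto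
  qed
  moreover have "?g I = ?g J" if "?g I \<subseteq> J" "?g J \<subseteq> I" for I J
    using query_tree_consistent[OF that] by simp
  ultimately show ?thesis
    unfolding nv
    by (intro exI[of _ "?g ` independent_sets H"] exI[of _ ?f] exI[of _ ?g])
       (auto simp: V_def)
qed

end
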